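(* For any finite fragment $T$ of Heyting arithmetic $\mathsf{HA}$, there are formulas $\varphi$ and $\psi$ of arithmetic (in negation-normal form) such that (1) Peano arithmetic $\mathsf{PA}$ proves both $\varphi$ and $\varphi\rightarrow\psi$, but (2) $T$ together with $\varphi^{\mathit{awk}}$ and $(\varphi\rightarrow\psi)^{\mathit{awk}}$ does not prove $\psi^{\mathit{awk}}$.
   Context: Logical symbols are $\forall,\exists,\land,\lor,\rightarrow,\bot$, with $\lnot\varphi$ defined as $\varphi\rightarrow\bot$. A formula is in negation-normal form if it is built from atomic and negated atomic formulas using $\land,\lor,\forall,\exists$; every classical formula is identified with its canonical negation-normal form equivalent (e.g. $\theta\rightarrow\eta$ becomes $\sim\theta\lor\eta$). For $\varphi$ in negation-normal form, $\sim\varphi$ is obtained by exchanging $\land$ with $\lor$, $\forall$ with $\exists$, and each atomic formula with its negation. The awkward translation is $\varphi^{\mathit{awk}} := \lnot(\sim\varphi)$. The language of arithmetic contains symbols for all primitive recursive functions, so negated atomic formulas have atomic equivalents. A finite fragment of $\mathsf{HA}$ is a subtheory axiomatized by finitely many theorems of $\mathsf{HA}$. *)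

theory Defs
  imports Main
begin

text \<open>Codes for primitive recursive functions (one function symbol per code).
  PComp m f gs : arity m, x maps to f(g1 x, ..., gk x).
  PRec f g     : R(0, xs) = f(xs),  R(S y, xs) = g(y, R(y,xs), xs).\<close>
datatype prfn = PZ | PS | PProj nat nat | PComp nat prfn "prfn list" | PRec prfn prfn

fun arity :: "prfn \<Rightarrow> nat" where
  "arity PZ = 0"
| "arity PS = 1"
| "arity (PProj n i) = n"
| "arity (PComp m f gs) = m"
| "arity (PRec f g) = Suc (arity f)"

fun wf_prf :: "prfn \<Rightarrow> bool" where
  "wf_prf PZ = True"
| "wf_prf PS = True"
| "wf_prf (PProj n i) = (i < n)"
| "wf_prf (PComp m f gs) = (wf_prf f \<and> length gs = arity f \<and>
      (\<forall>g\<in>set gs. wf_prf g \<and> arity g = m))"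
| "wf_prf (PRec f g) = (wf_prf f \<and> wf_prf g \<and> arity g = arity f + 2)"

datatype tm = TVar nat | TApp prfn "tm list"

datatype fm = FEq tm tm | FBot | FAnd fm fm | FOr fm fm | FImp fm fm | FAll fm | FEx fm

fun wf_tm :: "tm \<Rightarrow> bool" where
  "wf_tm (TVar i) = True"
| "wf_tm (TApp f ts) = (wf_prf f \<and> length ts = arity f \<and> (\<forall>t\<in>set ts. wf_tm t))"

fun wf_fm :: "fm \<Rightarrow> bool" where
  "wf_fm (FEq s t) = (wf_tm s \<and> wf_tm t)"
| "wf_fm FBot = True"
| "wf_fm (FAnd A B) = (wf_fm A \<and> wf_fm B)"
| "wf_fm (FOr A B) = (wf_fm A \<and> wf_fm B)"
| "wf_fm (FImp A B) = (wf_fm A \<and> wf_fm B)"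
| "wf_fm (FAll A) = wf_fm A"
| "wf_fm (FEx A) = wf_fm A"

definition FNot :: "fm \<Rightarrow> fm" where "FNot A = FImp A FBot"

definition zero :: tm where "zero = TApp PZ []"
definition succ :: "tm \<Rightarrow> tm" where "succ t = TApp PS [t]"

fun liftt :: "nat \<Rightarrow> tm \<Rightarrow> tm" where
  "liftt k (TVar i) = (if i < k then TVar i else TVar (Suc i))"
| "liftt k (TApp f ts) = TApp f (map (liftt k) ts)"

fun liftf :: "nat \<Rightarrow> fm \<Rightarrow> fm" where
  "liftf k (FEq s t) = FEq (liftt k s) (liftt k t)"
| "liftf k FBot = FBot"
| "liftf k (FAnd A B) = FAnd (liftf k A) (liftf k B)"
| "liftf k (FOr A B) = FOr (liftf k A) (liftf k B)"
| "liftf k (FImp A B) = FImp (liftf k A) (liftf k B)"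
| "liftf k (FAll A) = FAll (liftf (Suc k) A)"
| "liftf k (FEx A) = FEx (liftf (Suc k) A)"

fun substt :: "nat \<Rightarrow> tm \<Rightarrow> tm \<Rightarrow> tm" where
  "substt k u (TVar i) = (if i < k then TVar i else if i = k then u else TVar (i - 1))"
| "substt k u (TApp f ts) = TApp f (map (substt k u) ts)"

fun substf :: "nat \<Rightarrow> tm \<Rightarrow> fm \<Rightarrow> fm" where
  "substf k u (FEq s t) = FEq (substt k u s) (substt k u t)"
| "substf k u FBot = FBot"
| "substf k u (FAnd A B) = FAnd (substf k u A) (substf k u B)"
| "substf k u (FOr A B) = FOr (substf k u A) (substf k u B)"
| "substf k u (FImp A B) = FImp (substf k u A) (substf k u B)"
| "substf k u (FAll A) = FAll (substf (Suc k) (liftt 0 u) A)"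
| "substf k u (FEx A) = FEx (substf (Suc k) (liftt 0 u) A)"

text \<open>deriv c Ax \<Gamma> A: A is derivable from the nonlogical axioms Ax (free variables
  read as universally closed, since Ax is not affected by the eigenvariable
  condition) and the hypotheses \<Gamma> (free variables are parameters).\<close>
inductive deriv :: "bool \<Rightarrow> fm set \<Rightarrow> fm set \<Rightarrow> fm \<Rightarrow> bool" for c Ax where
  Axiom: "A \<in> Ax \<Longrightarrow> deriv c Ax \<Gamma> A"
| Hyp: "A \<in> \<Gamma> \<Longrightarrow> deriv c Ax \<Gamma> A"
| BotE: "deriv c Ax \<Gamma> FBot \<Longrightarrow> deriv c Ax \<Gamma> A"
| ImpI: "deriv c Ax (insert A \<Gamma>) B \<Longrightarrow> deriv c Ax \<Gamma> (FImp A B)"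
| ImpE: "deriv c Ax \<Gamma> (FImp A B) \<Longrightarrow> deriv c Ax \<Gamma> A \<Longrightarrow> deriv c Ax \<Gamma> B"
| AndI: "deriv c Ax \<Gamma> A \<Longrightarrow> deriv c Ax \<Gamma> B \<Longrightarrow> deriv c Ax \<Gamma> (FAnd A B)"
| AndE1: "deriv c Ax \<Gamma> (FAnd A B) \<Longrightarrow> deriv c Ax \<Gamma> A"
| AndE2: "deriv c Ax \<Gamma> (FAnd A B) \<Longrightarrow> deriv c Ax \<Gamma> B"
| OrI1: "deriv c Ax \<Gamma> A \<Longrightarrow> deriv c Ax \<Gamma> (FOr A B)"
| OrI2: "deriv c Ax \<Gamma> B \<Longrightarrow> deriv c Ax \<Gamma> (FOr A B)"
| OrE: "deriv c Ax \<Gamma> (FOr A B) \<Longrightarrow> deriv c Ax (insert A \<Gamma>) C \<Longrightarrow>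
        deriv c Ax (insert B \<Gamma>) C \<Longrightarrow> deriv c Ax \<Gamma> C"
| AllI: "deriv c Ax (liftf 0 ` \<Gamma>) A \<Longrightarrow> deriv c Ax \<Gamma> (FAll A)"
| AllE: "deriv c Ax \<Gamma> (FAll A) \<Longrightarrow> deriv c Ax \<Gamma> (substf 0 t A)"
| ExI: "deriv c Ax \<Gamma> (substf 0 t A) \<Longrightarrow> deriv c Ax \<Gamma> (FEx A)"
| ExE: "deriv c Ax \<Gamma> (FEx A) \<Longrightarrow> deriv c Ax (insert A (liftf 0 ` \<Gamma>)) (liftf 0 B) \<Longrightarrow>
        deriv c Ax \<Gamma> B"
| Refl: "deriv c Ax \<Gamma> (FEq t t)"
| EqSubst: "deriv c Ax \<Gamma> (FEq s t) \<Longrightarrow> deriv c Ax \<Gamma> (substf 0 s A) \<Longrightarrow>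
        deriv c Ax \<Gamma> (substf 0 t A)"
| DNE: "c \<Longrightarrow> deriv c Ax \<Gamma> (FNot (FNot A)) \<Longrightarrow> deriv c Ax \<Gamma> A"

definition vars :: "nat \<Rightarrow> tm list" where "vars n = map TVar [0..<n]"

fun defeqs :: "prfn \<Rightarrow> fm set" where
  "defeqs PZ = {}"
| "defeqs PS = {}"
| "defeqs (PProj n i) = {FEq (TApp (PProj n i) (vars n)) (TVar i)}"
| "defeqs (PComp m f gs) =
     {FEq (TApp (PComp m f gs) (vars m)) (TApp f (map (\<lambda>g. TApp g (vars m)) gs))}"
| "defeqs (PRec f g) =
     (let k = arity f; xs = map TVar [1..<Suc k] in
      {FEq (TApp (PRec f g) (zero # vars k)) (TApp f (vars k)),
       FEq (TApp (PRec f g) (succ (TVar 0) # xs))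
           (TApp g (TVar 0 # TApp (PRec f g) (TVar 0 # xs) # xs))})"

definition induction_ax :: "fm \<Rightarrow> fm" where
  "induction_ax A = FImp (FAnd (substf 0 zero A)
                               (FAll (FImp A (substf 0 (succ (TVar 0)) (liftf 1 A)))))
                         (FAll A)"

definition HA_axioms :: "fm set" where
  "HA_axioms =
     {FNot (FEq (succ (TVar 0)) zero),
      FImp (FEq (succ (TVar 0)) (succ (TVar 1))) (FEq (TVar 0) (TVar 1))}
   \<union> (\<Union>f\<in>{f. wf_prf f}. defeqs f)
   \<union> {induction_ax A | A. wf_fm A}"

definition HA_prov :: "fm \<Rightarrow> bool" where "HA_prov A = deriv False HA_axioms {} A"
definition PA_prov :: "fm \<Rightarrow> bool" where "PA_prov A = deriv True HA_axioms {} A"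

fun nnf :: "fm \<Rightarrow> bool" where
  "nnf (FEq s t) = True"
| "nnf (FImp (FEq s t) FBot) = True"
| "nnf (FAnd A B) = (nnf A \<and> nnf B)"
| "nnf (FOr A B) = (nnf A \<and> nnf B)"
| "nnf (FAll A) = nnf A"
| "nnf (FEx A) = nnf A"
| "nnf _ = False"

text \<open>The dual \<open>\<sim>\<close>, meaningful on nnf formulas (other inputs: arbitrary value).\<close>
fun dual :: "fm \<Rightarrow> fm" where
  "dual (FEq s t) = FNot (FEq s t)"
| "dual (FImp (FEq s t) FBot) = FEq s t"
| "dual (FAnd A B) = FOr (dual A) (dual B)"
| "dual (FOr A B) = FAnd (dual A) (dual B)"
| "dual (FAll A) = FEx (dual A)"
| "dual (FEx A) = FAll (dual A)"
| "dual A = FBot"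

definition awk :: "fm \<Rightarrow> fm" where "awk A = FNot (dual A)"

text \<open>Classical implication, identified with its canonical nnf \<open>\<sim>A \<or> B\<close>.\<close>
definition cimp :: "fm \<Rightarrow> fm \<Rightarrow> fm" where "cimp A B = FOr (dual A) B"

end

theory Submission
  imports Defs Complex_Main
begin

text \<open>A finite \<open>T\<close> mentions only finitely many function symbols, hence says nothing about some
  projection symbol \<open>g\<close>, although Peano arithmetic proves its defining equation \<open>\<psi>\<close>. Let \<open>e(x, y)\<close>
  be the equation \<open>g(x, y, \<dots>, y) = x\<close>, let \<open>\<chi>\<close> be the instance \<open>\<forall>x. (\<exists>y. e) \<or> (\<forall>y. \<not> e)\<close> of excluded
  middle, and put \<open>\<phi> = \<psi> \<or> \<chi>\<close>. It suffices to find a Kripke model of \<open>T\<close> that refutes \<open>\<psi>\<close> and in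
  which no node forces \<open>\<chi>\<close>; no node ever forces \<open>\<sim>\<chi>\<close>. The nodes are an ascending \<open>\<omega>\<close>-chain of
  proper elementary extensions of the standard model, namely the functions of the first \<open>k\<close>
  coordinates modulo one ultrafilter on \<open>nat \<Rightarrow> nat\<close>. By elementarity, forcing of formulas without
  \<open>g\<close> is classical truth, so \<open>T\<close> is forced. The symbol \<open>g\<close> can be interpreted freely, so that at
  every node \<open>k\<close> the number \<open>k\<close> acquires a \<open>y\<close> with \<open>e(k, y)\<close> only at node \<open>k + 1\<close>.\<close>

section \<open>Kripke semantics\<close>

text \<open>The semantic side of de Bruijn indices: \<open>ins 0\<close> enters a quantifier, and
  positions above 0 let the lifting and substitution lemmas pass under binders.\<close>

definition ins :: "nat \<Rightarrow> 'a \<Rightarrow> (nat \<Rightarrow> 'a) \<Rightarrow> nat \<Rightarrow> 'a" where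
  "ins k d \<rho> = (\<lambda>i. if i < k then \<rho> i else if i = k then d else \<rho> (i - 1))"

lemma ins_0_ins: "ins 0 e (ins k d \<rho>) = ins (Suc k) d (ins 0 e \<rho>)"
  by (auto simp: ins_def fun_eq_iff)

lemma ins_simps [simp]:
  "ins 0 d \<rho> 0 = d" "ins 0 d \<rho> (Suc i) = \<rho> i"
  by (auto simp: ins_def)

fun tval :: "(prfn \<Rightarrow> 'a list \<Rightarrow> 'a) \<Rightarrow> (nat \<Rightarrow> 'a) \<Rightarrow> tm \<Rightarrow> 'a" where
  "tval I \<rho> (TVar i) = \<rho> i"
| "tval I \<rho> (TApp f ts) = I f (map (tval I \<rho>) ts)"

lemma tval_lift: "tval I (ins k d \<rho>) (liftt k t) = tval I \<rho> t"
  by (induction t) (auto simp: ins_def comp_def cong: map_cong)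

lemma tval_subst: "tval I \<rho> (substt k u t) = tval I (ins k (tval I \<rho> u) \<rho>) t"
  by (induction t) (auto simp: ins_def comp_def cong: map_cong)

text \<open>The domains grow inside one ambient type, while \<open>I\<close> and \<open>E\<close>
  are the same at every node, so the truth of an equation does not depend on the node. Taking
  equality to be a congruence \<open>E\<close> avoids quotients.\<close>

locale kripke =
  fixes D :: "'w::preorder \<Rightarrow> 'a set"
    and I :: "prfn \<Rightarrow> 'a list \<Rightarrow> 'a"
    and E :: "'a \<Rightarrow> 'a \<Rightarrow> bool"
  assumes D_mono: "v \<le> w \<Longrightarrow> D v \<subseteq> D w"
    and I_closed: "set xs \<subseteq> D w \<Longrightarrow> I f xs \<in> D w"
    and E_refl: "E x x"
    and E_sym: "E x y \<Longrightarrow> E y x"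
    and E_trans: "E x y \<Longrightarrow> E y z \<Longrightarrow> E x z"
    and I_cong: "list_all2 E xs ys \<Longrightarrow> E (I f xs) (I f ys)"
begin

fun forces :: "'w \<Rightarrow> (nat \<Rightarrow> 'a) \<Rightarrow> fm \<Rightarrow> bool" where
  "forces w \<rho> (FEq s t) = E (tval I \<rho> s) (tval I \<rho> t)"
| "forces w \<rho> FBot = False"
| "forces w \<rho> (FAnd A B) = (forces w \<rho> A \<and> forces w \<rho> B)"
| "forces w \<rho> (FOr A B) = (forces w \<rho> A \<or> forces w \<rho> B)"
| "forces w \<rho> (FImp A B) = (\<forall>v\<ge>w. forces v \<rho> A \<longrightarrow> forces v \<rho> B)"
| "forces w \<rho> (FAll A) = (\<forall>v\<ge>w. \<forall>d\<in>D v. forces v (ins 0 d \<rho>) A)"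
| "forces w \<rho> (FEx A) = (\<exists>d\<in>D w. forces w (ins 0 d \<rho>) A)"

lemma forces_FNot [simp]: "forces w \<rho> (FNot A) \<longleftrightarrow> (\<forall>v\<ge>w. \<not> forces v \<rho> A)"
  by (simp add: FNot_def)

lemma forces_lift: "forces w (ins k d \<rho>) (liftf k A) = forces w \<rho> A"
  by (induction A arbitrary: w k \<rho>) (simp_all add: tval_lift ins_0_ins)

lemma forces_subst: "forces w \<rho> (substf k u A) = forces w (ins k (tval I \<rho> u) \<rho>) A"
proof (induction A arbitrary: w k u \<rho>)
  case (FAll A)
  then show ?case using tval_lift[of I 0] by (simp add: ins_0_ins)
next
  case (FEx A)
  then show ?case using tval_lift[of I 0] by (simp add: ins_0_ins)
qed (simp_all add: tval_subst)

lemma forces_mono: "forces v \<rho> A \<Longrightarrow> v \<le> w \<Longrightarrow> forces w \<rho> A"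
proof (induction A arbitrary: v w \<rho>)
  case (FImp A B)
  then show ?case by (meson forces.simps(5) order_trans)
next
  case (FAll A)
  then show ?case by (meson forces.simps(6) order_trans)
next
  case (FEx A)
  then show ?case using D_mono by (metis forces.simps(7) subsetD)
qed auto

lemma tval_cong: "(\<And>i. E (\<rho> i) (\<rho>' i)) \<Longrightarrow> E (tval I \<rho> t) (tval I \<rho>' t)"
  by (induction t) (auto intro!: I_cong simp: list_all2_conv_all_nth)

lemma forces_cong: "(\<And>i. E (\<rho> i) (\<rho>' i)) \<Longrightarrow> forces w \<rho> A = forces w \<rho>' A"
proof (induction A arbitrary: w \<rho> \<rho>')
  case (FEq s t)
  then show ?case using tval_cong[of \<rho> \<rho>'] E_sym E_trans by (metis forces.simps(1))
next
  case (FAll A)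
  then have "forces v (ins 0 d \<rho>) A = forces v (ins 0 d \<rho>') A" for v d
    by (intro FAll.IH) (auto simp: ins_def E_refl)
  then show ?case by simp
next
  case (FEx A)
  then have "forces v (ins 0 d \<rho>) A = forces v (ins 0 d \<rho>') A" for v d
    by (intro FEx.IH) (auto simp: ins_def E_refl)
  then show ?case by simp
next
  case (FImp A B)
  show ?case by (simp add: FImp.IH[OF FImp.prems])
next
  case (FAnd A B)
  show ?case by (simp add: FAnd.IH[OF FAnd.prems])
next
  case (FOr A B)
  show ?case by (simp add: FOr.IH[OF FOr.prems])
qed simp

lemma tval_closed: "(\<And>i. \<rho> i \<in> D w) \<Longrightarrow> tval I \<rho> t \<in> D w"
  by (induction t) (auto intro!: I_closed)

text \<open>Axioms are assumed at all nodes and assignments, because \<open>AllI\<close> does not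
  restrict their free variables; hypotheses only at the given ones.\<close>

theorem soundness:
  assumes "deriv False Ax \<Gamma> A"
    and Ax: "\<And>B w \<rho>. B \<in> Ax \<Longrightarrow> (\<And>i. \<rho> i \<in> D w) \<Longrightarrow> forces w \<rho> B"
    and "\<And>i. \<rho> i \<in> D w" and "\<And>B. B \<in> \<Gamma> \<Longrightarrow> forces w \<rho> B"
  shows "forces w \<rho> A"
  using assms(1,3,4)
proof (induction arbitrary: w \<rho> rule: deriv.induct)
  case (Axiom A \<Gamma>)
  then show ?case using Ax by blast
next
  case (ImpI A \<Gamma> B)
  have "forces v \<rho> B" if "w \<le> v" "forces v \<rho> A" for v
    using ImpI.prems D_mono[OF \<open>w \<le> v\<close>] that by (intro ImpI.IH) (auto intro: forces_mono)
  then show ?case by simp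
next
  case (ImpE \<Gamma> A B)
  then show ?case by (meson forces.simps(5) order_refl)
next
  case (OrE \<Gamma> A B C)
  from OrE.IH(1)[of \<rho> w] OrE.prems consider "forces w \<rho> A" | "forces w \<rho> B" by auto
  then show ?case
  proof cases
    case 1
    then show ?thesis using OrE.prems by (intro OrE.IH(2)) auto
  next
    case 2
    then show ?thesis using OrE.prems by (intro OrE.IH(3)) auto
  qed
next
  case (AllI \<Gamma> A)
  have "forces v (ins 0 d \<rho>) A" if "w \<le> v" "d \<in> D v" for v d
  proof (rule AllI.IH)
    show "ins 0 d \<rho> i \<in> D v" for i
      using AllI.prems(1) D_mono[OF \<open>w \<le> v\<close>] \<open>d \<in> D v\<close> by (auto simp: ins_def)
    show "forces v (ins 0 d \<rho>) B" if "B \<in> liftf 0 ` \<Gamma>" for B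
      using that forces_mono[OF AllI.prems(2) \<open>w \<le> v\<close>] by (auto simp: forces_lift)
  qed
  then show ?case by simp
next
  case (AllE \<Gamma> A t)
  then have "forces w \<rho> (FAll A)" "tval I \<rho> t \<in> D w" by (auto intro: tval_closed)
  then show ?case unfolding forces_subst by (meson forces.simps(6) order_refl)
next
  case (ExI \<Gamma> t A)
  then have "forces w \<rho> (substf 0 t A)" "tval I \<rho> t \<in> D w" by (auto intro: tval_closed)
  then show ?case by (auto simp: forces_subst)
next
  case (ExE \<Gamma> A B)
  then have "forces w \<rho> (FEx A)" by auto
  then obtain d where d: "d \<in> D w" "forces w (ins 0 d \<rho>) A" by auto
  have "forces w (ins 0 d \<rho>) (liftf 0 B)"
    using ExE.prems d
    by (intro ExE.IH(2)) (auto simp: forces_lift, auto simp: ins_def)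
  then show ?case by (simp add: forces_lift)
next
  case (EqSubst \<Gamma> s t A)
  then have "forces w \<rho> (FEq s t)" "forces w \<rho> (substf 0 s A)" by blast+
  moreover from this(1)
  have "forces w (ins 0 (tval I \<rho> s) \<rho>) A = forces w (ins 0 (tval I \<rho> t) \<rho>) A"
    by (intro forces_cong) (auto simp: ins_def E_refl)
  ultimately show ?case by (simp add: forces_subst)
qed (auto simp: E_refl)

end

section \<open>The standard model\<close>

fun peval :: "prfn \<Rightarrow> nat list \<Rightarrow> nat" where
  "peval PZ xs = 0"
| "peval PS xs = Suc (hd xs)"
| "peval (PProj n i) xs = xs ! i"
| "peval (PComp m f gs) xs = peval f (map (\<lambda>g. peval g xs) gs)"
| "peval (PRec f g) xs = rec_nat (peval f (tl xs)) (\<lambda>y r. peval g (y # r # tl xs)) (hd xs)"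

text \<open>With a single node, forcing is classical truth, so \<open>std.soundness\<close> yields
  truth in the standard model.\<close>

interpretation std: kripke "\<lambda>_::unit. UNIV" peval "(=)"
  by unfold_locales (auto simp: list.rel_eq)

lemma tval_succ [simp]: "tval peval \<rho> (succ t) = Suc (tval peval \<rho> t)"
  by (simp add: succ_def)

lemma tval_zero [simp]: "tval peval \<rho> zero = 0"
  by (simp add: zero_def)

lemma std_defeqs:
  assumes "wf_prf f" "A \<in> defeqs f"
  shows "std.forces w \<rho> A"
  using assms
  by (cases f) (auto simp: vars_def comp_def Let_def nth_map simp del: upt_Suc)

lemma std_induction_ax: "std.forces w \<rho> (induction_ax A)"
proof -
  \<comment> \<open>The old value \<open>a\<close> sits at index 1, which \<open>liftf 1\<close>
    skips, and \<open>succ (TVar 0)\<close> evaluates to \<open>Suc a\<close>.\<close>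
  have step: "std.forces w (ins 0 a \<rho>) (substf 0 (succ (TVar 0)) (liftf 1 A))
      = std.forces w (ins 0 (Suc a) \<rho>) A" for a w
    using std.forces_lift[of w 1 a "ins 0 (Suc a) \<rho>" A] ins_0_ins[of "Suc a" 0 a \<rho>]
    by (simp add: std.forces_subst)
  have "std.forces v (ins 0 a \<rho>) A"
    if "std.forces v \<rho> (substf 0 zero A)"
      and "std.forces v \<rho> (FAll (FImp A (substf 0 (succ (TVar 0)) (liftf 1 A))))" for v a
  proof (induction a)
    case 0
    show ?case using that(1) by (simp add: std.forces_subst)
  next
    case (Suc a)
    have "std.forces v (ins 0 a \<rho>) (FImp A (substf 0 (succ (TVar 0)) (liftf 1 A)))"
      using that(2) unfolding std.forces.simps(6) by blast
    with Suc show ?case unfolding std.forces.simps(5) step by blast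
  qed
  then have "std.forces v \<rho> (FAll A)"
    if "std.forces v \<rho> (substf 0 zero A)"
      and "std.forces v \<rho> (FAll (FImp A (substf 0 (succ (TVar 0)) (liftf 1 A))))" for v
    using that unfolding std.forces.simps(6)[of v \<rho> A] by (metis (full_types) old.unit.exhaust)
  then show ?thesis
    unfolding induction_ax_def std.forces.simps(3,5) by blast
qed

lemma std_HA_prov:
  assumes "HA_prov A"
  shows "std.forces w \<rho> A"
proof (rule std.soundness[OF assms[unfolded HA_prov_def]])
  fix B \<rho> w assume "B \<in> HA_axioms"
  then show "std.forces w \<rho> B"
    unfolding HA_axioms_def using std_defeqs std_induction_ax by auto
qed auto


section \<open>An iterated ultrapower\<close>

text \<open>Finer filters have more eventual properties, so Zorn's lemma for inclusion of the sets
  \<open>ev G\<close> gives a minimal proper filter below \<open>F\<close>.\<close>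

lemma ultrafilter_below:
  assumes "F \<noteq> bot"
  obtains U where "U \<le> F" "U \<noteq> bot" "\<And>P. eventually P U \<or> (\<forall>\<^sub>F x in U. \<not> P x)"
proof -
  define ev :: "'a filter \<Rightarrow> ('a \<Rightarrow> bool) set" where "ev G = {P. eventually P G}" for G
  have ev_le: "ev G \<subseteq> ev G' \<longleftrightarrow> G' \<le> G" for G G'
    by (auto simp: ev_def le_filter_def)
  define \<A> where "\<A> = ev ` {G. G \<le> F \<and> G \<noteq> bot}"
  have "\<exists>M\<in>\<A>. \<forall>X\<in>\<A>. M \<subseteq> X \<longrightarrow> X = M"
  proof (rule subset_Zorn_nonempty)
    show "\<A> \<noteq> {}" using assms by (auto simp: \<A>_def)
  next
    fix \<C> assume ne: "\<C> \<noteq> {}" and ch: "subset.chain \<A> \<C>"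
    define B where "B = {G. G \<le> F \<and> G \<noteq> bot \<and> ev G \<in> \<C>}"
    have C: "\<C> = ev ` B" using ch by (auto simp: B_def subset_chain_def \<A>_def)
    \<comment> \<open>A chain is directed, so a property holds eventually in \<open>Inf B\<close>
      exactly if it does in some member; hence the infimum stays proper.\<close>
    have "\<exists>x\<in>B. x \<le> inf G H" if "G \<in> B" "H \<in> B" for G H
    proof -
      have "ev G \<in> \<C>" "ev H \<in> \<C>" using that by (auto simp: B_def)
      then have "ev G \<subseteq> ev H \<or> ev H \<subseteq> ev G" using ch by (simp add: subset_chain_def)
      then have "G \<le> H \<or> H \<le> G" unfolding ev_le by auto
      then show ?thesis using that by (auto simp: inf_absorb1 inf_absorb2)
    qed
    then have Inf: "eventually P (Inf B) \<longleftrightarrow> (\<exists>G\<in>B. eventually P G)" for P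
      using ne C by (intro eventually_Inf_base) auto
    have "Inf B \<noteq> bot"
      unfolding trivial_limit_def Inf by (simp add: B_def trivial_limit_def)
    moreover obtain G where "G \<in> B" using ne C by auto
    then have "Inf B \<le> F" by (rule Inf_lower2) (use \<open>G \<in> B\<close> in \<open>simp add: B_def\<close>)
    moreover have "ev (Inf B) = \<Union>\<C>"
      unfolding C ev_def Inf by blast
    ultimately show "\<Union>\<C> \<in> \<A>"
      unfolding \<A>_def by (metis (mono_tags, lifting) imageI mem_Collect_eq)
  qed
  then obtain U where U: "U \<le> F" "U \<noteq> bot"
    and max: "\<And>G. G \<le> F \<Longrightarrow> G \<noteq> bot \<Longrightarrow> G \<le> U \<Longrightarrow> U \<le> G"
    unfolding \<A>_def by (auto simp flip: ev_le)
  have "\<forall>\<^sub>F x in U. \<not> P x" if "\<not> eventually P U" for P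
  proof -
    \<comment> \<open>Adding the complement of \<open>P\<close> keeps the filter proper, so by
      maximality \<open>U\<close> already contains it.\<close>
    let ?G = "inf U (principal {x. \<not> P x})"
    have "?G \<noteq> bot"
      using that by (simp add: trivial_limit_def eventually_inf_principal)
    then have "U \<le> ?G" using U by (intro max) (auto intro: le_infI1)
    moreover have "\<forall>\<^sub>F x in ?G. \<not> P x" by (simp add: eventually_inf_principal)
    ultimately show ?thesis by (rule filter_leD)
  qed
  with U show ?thesis by (intro that) auto
qed

text \<open>\<open>stage 0\<close> consists of the constants, so the root represents the standard
  model.\<close>

definition stage :: "nat \<Rightarrow> ((nat \<Rightarrow> nat) \<Rightarrow> nat) set" where
  "stage k = {f. \<forall>x y. (\<forall>m<k. x m = y m) \<longrightarrow> f x = f y}"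

lemma stage_mono: "k \<le> l \<Longrightarrow> stage k \<subseteq> stage l"
  by (auto simp: stage_def)

lemma const_in_stage [simp]: "(\<lambda>_. c) \<in> stage k"
  by (simp add: stage_def)

text \<open>Each coordinate exceeds the value of \<open>h k\<close> at the coordinates already
  built, padded by 0; a function in \<open>stage k\<close> does not see the padding.\<close>

fun diag :: "(nat \<Rightarrow> (nat \<Rightarrow> nat) \<Rightarrow> nat) \<Rightarrow> nat \<Rightarrow> nat" where
  "diag h k = Suc (h k (\<lambda>m. if m < k then diag h m else 0))"

declare diag.simps [simp del]

lemma diag_greater:
  assumes "h k \<in> stage k"
  shows "h k (diag h) < diag h k"
proof -
  have "h k (diag h) = h k (\<lambda>m. if m < k then diag h m else 0)"
    using assms by (simp add: stage_def)
  then show ?thesis by (simp add: diag.simps)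
qed

text \<open>Under such an ultrafilter coordinate \<open>k\<close> lies above every function of the
  coordinates below \<open>k\<close>, so that \<open>stage (Suc k)\<close> represents a proper extension of \<open>stage k\<close>.\<close>

lemma iterated_ultrafilter_exists:
  obtains U :: "(nat \<Rightarrow> nat) filter"
  where "U \<noteq> bot" "\<And>P. eventually P U \<or> (\<forall>\<^sub>F x in U. \<not> P x)"
    "\<And>k f. f \<in> stage k \<Longrightarrow> \<forall>\<^sub>F x in U. f x < x k"
proof -
  define H where "H = {h :: nat \<Rightarrow> (nat \<Rightarrow> nat) \<Rightarrow> nat. \<forall>k. h k \<in> stage k}"
  define B :: "(nat \<Rightarrow> (nat \<Rightarrow> nat) \<Rightarrow> nat) \<Rightarrow> (nat \<Rightarrow> nat) set"
    where "B h = {x. \<forall>k. h k x < x k}" for h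
  define F where "F = (INF h\<in>H. principal (B h))"
  have const: "(\<lambda>_ _. 0) \<in> H" by (simp add: H_def)
  have "\<exists>x\<in>H. principal (B x) \<le> inf (principal (B h)) (principal (B h'))"
    if "h \<in> H" "h' \<in> H" for h h'
  proof
    \<comment> \<open>Pointwise maxima stay in the stages, so the sets \<open>B h\<close> form a
      filter base.\<close>
    show "(\<lambda>k x. max (h k x) (h' k x)) \<in> H"
      unfolding H_def mem_Collect_eq
    proof
      show "(\<lambda>x. max (h k x) (h' k x)) \<in> stage k" for k
        using that[unfolded H_def, THEN CollectD, THEN spec, of k]
        unfolding stage_def mem_Collect_eq by metis
    qed
  qed (auto simp: B_def)
  then have F: "eventually P F \<longleftrightarrow> (\<exists>h\<in>H. \<forall>x\<in>B h. P x)" for P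
    unfolding F_def using const by (subst eventually_INF_base) (auto simp: eventually_principal)
  have "diag h \<in> B h" if "h \<in> H" for h
    using that by (simp add: B_def H_def diag_greater)
  then have "F \<noteq> bot" unfolding trivial_limit_def F by blast
  then obtain U where U: "U \<le> F" "U \<noteq> bot" "\<And>P. eventually P U \<or> (\<forall>\<^sub>F x in U. \<not> P x)"
    by (rule ultrafilter_below) blast
  have "\<forall>\<^sub>F x in U. f x < x k" if "f \<in> stage k" for k f
  proof -
    have "(\<lambda>l. if l = k then f else (\<lambda>_. 0)) \<in> H" using that by (simp add: H_def)
    then have "\<forall>\<^sub>F x in F. f x < x k"
      unfolding F B_def by (rule bexI[rotated]) (auto dest: spec[of _ k])
    then show ?thesis using U(1) by (rule filter_leD[rotated])
  qed
  with U that show ?thesis by blast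
qed

section \<open>Function symbols occurring in formulas\<close>

fun symt :: "tm \<Rightarrow> prfn set" where
  "symt (TVar i) = {}"
| "symt (TApp f ts) = insert f (\<Union>t\<in>set ts. symt t)"

fun symf :: "fm \<Rightarrow> prfn set" where
  "symf (FEq s t) = symt s \<union> symt t"
| "symf FBot = {}"
| "symf (FAnd A B) = symf A \<union> symf B"
| "symf (FOr A B) = symf A \<union> symf B"
| "symf (FImp A B) = symf A \<union> symf B"
| "symf (FAll A) = symf A"
| "symf (FEx A) = symf A"

lemma finite_symt: "finite (symt t)"
  by (induction t) auto

lemma finite_symf: "finite (symf A)"
  by (induction A) (auto simp: finite_symt)

section \<open>The Kripke model on the iterated ultrapower\<close>

locale iterated_ultrapower =
  fixes U :: "(nat \<Rightarrow> nat) filter" and g :: prfn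
  assumes proper: "U \<noteq> bot"
    and ultra: "\<And>P. eventually P U \<or> (\<forall>\<^sub>F x in U. \<not> P x)"
    and dominates: "\<And>k f. f \<in> stage k \<Longrightarrow> \<forall>\<^sub>F x in U. f x < x k"
begin

definition eqv :: "((nat \<Rightarrow> nat) \<Rightarrow> nat) \<Rightarrow> ((nat \<Rightarrow> nat) \<Rightarrow> nat) \<Rightarrow> bool" where
  "eqv a b \<longleftrightarrow> (\<forall>\<^sub>F x in U. a x = b x)"

text \<open>The symbol \<open>g\<close> is interpreted so that \<open>g(a, b, \<dots>) = a\<close> exactly when \<open>a\<close> is a standard
  number \<open>k\<close> and \<open>b\<close> is the \<open>k\<close>-th coordinate, which only appears at node \<open>k + 1\<close>.\<close>

definition rel :: "((nat \<Rightarrow> nat) \<Rightarrow> nat) \<Rightarrow> ((nat \<Rightarrow> nat) \<Rightarrow> nat) \<Rightarrow> bool" where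
  "rel a b \<longleftrightarrow> (\<exists>k. eqv a (\<lambda>_. k) \<and> eqv b (\<lambda>x. x k))"

text \<open>The fallback a + 1 differs from a at every point and depends on the same coordinates, so
  \<open>g\<close> leaves each stage closed. Testing \<open>rel\<close> on whole functions makes
  \<open>g\<close> respect \<open>eqv\<close>; the other symbols act pointwise.\<close>

definition interp :: "prfn \<Rightarrow> ((nat \<Rightarrow> nat) \<Rightarrow> nat) list \<Rightarrow> (nat \<Rightarrow> nat) \<Rightarrow> nat" where
  "interp f as =
     (if f = g then
        if 2 \<le> length as then if rel (as ! 0) (as ! 1) then as ! 0 else (\<lambda>x. Suc ((as ! 0) x))
        else (\<lambda>_. 0)
      else (\<lambda>x. peval f (map (\<lambda>a. a x) as)))"

lemma eqv_refl [simp]: "eqv a a"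
  by (simp add: eqv_def)

lemma eqv_sym: "eqv a b \<Longrightarrow> eqv b a"
  by (simp add: eqv_def eq_commute)

lemma eqv_trans: "eqv a b \<Longrightarrow> eqv b c \<Longrightarrow> eqv a c"
  unfolding eqv_def by (auto elim: eventually_elim2)

lemma eqv_Suc: "eqv a b \<Longrightarrow> eqv (\<lambda>x. Suc (a x)) (\<lambda>x. Suc (b x))"
  by (simp add: eqv_def)

lemma not_eqv_Suc: "\<not> eqv (\<lambda>x. Suc (a x)) a"
  using proper by (simp add: eqv_def)

lemma eqv_const_iff: "eqv (\<lambda>_. k) (\<lambda>_. l) \<longleftrightarrow> k = l"
  using proper by (simp add: eqv_def)

lemma rel_cong: "eqv a a' \<Longrightarrow> eqv b b' \<Longrightarrow> rel a b = rel a' b'"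
  unfolding rel_def by (meson eqv_sym eqv_trans)

lemma coordinate_not_eqv: "f \<in> stage k \<Longrightarrow> \<not> eqv f (\<lambda>x. x k)"
proof
  assume "f \<in> stage k" "eqv f (\<lambda>x. x k)"
  then have "\<forall>\<^sub>F x in U. False"
    unfolding eqv_def using dominates[of f k] by (auto elim: eventually_elim2)
  then show False using proper by simp
qed

lemma eventually_map_eq:
  "list_all2 eqv as bs \<Longrightarrow> \<forall>\<^sub>F x in U. map (\<lambda>a. a x) as = map (\<lambda>a. a x) bs"
proof (induction rule: list_all2_induct)
  case (Cons a as b bs)
  then show ?case unfolding eqv_def by (auto elim: eventually_elim2)
qed simp

sublocale kripke stage interp eqv
proof
  fix as and w f assume as: "set as \<subseteq> stage w"
  show "interp f as \<in> stage w"
  proof (cases "f = g")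
    case True
    have "as ! 0 \<in> stage w" if "2 \<le> length as"
      using as that nth_mem[of 0 as] by (meson less_le_trans pos2 subsetD)
    then show ?thesis using True by (auto simp: interp_def stage_def)
  next
    case False
    have vals: "map (\<lambda>a. a x) as = map (\<lambda>a. a y) as" if "\<forall>m<w. x m = y m" for x y
      using as that by (auto simp: stage_def)
    have "interp f as x = interp f as y" if "\<forall>m<w. x m = y m" for x y
      using False by (simp only: interp_def if_False vals[OF that])
    then show ?thesis by (simp add: stage_def)
  qed
next
  fix as bs f assume *: "list_all2 eqv as bs"
  show "eqv (interp f as) (interp f bs)"
  proof (cases "f = g")
    case True
    have len: "length as = length bs" using * by (rule list_all2_lengthD)
    show ?thesis
    proof (cases "2 \<le> length as")
      case True
      then have "eqv (as ! 0) (bs ! 0)" "eqv (as ! 1) (bs ! 1)"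
        using list_all2_nthD[OF *, of 0] list_all2_nthD[OF *, of 1] by linarith+
      then show ?thesis
        using \<open>f = g\<close> len rel_cong[of "as ! 0" "bs ! 0" "as ! 1" "bs ! 1"] by (auto simp: interp_def eqv_Suc)
    qed (use len \<open>f = g\<close> in \<open>auto simp: interp_def\<close>)
  next
    case False
    from eventually_map_eq[OF *] have "\<forall>\<^sub>F x in U. interp f as x = interp f bs x"
      by eventually_elim (simp add: interp_def False)
    then show ?thesis by (simp add: eqv_def)
  qed
qed (auto intro: eqv_sym eqv_trans dest: stage_mono)

section \<open>The theorem of Los for formulas without \<open>g\<close>\<close>

lemma tval_pointwise:
  "g \<notin> symt t \<Longrightarrow> tval interp \<rho> t x = tval peval (\<lambda>i. \<rho> i x) t"
proof (induction t)
  case (TApp f ts)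
  then show ?case
    by (auto simp: interp_def comp_def intro!: arg_cong[of _ _ "peval f"])
qed simp

lemma ins_pointwise: "(\<lambda>i. ins 0 d \<rho> i x) = ins 0 (d x) (\<lambda>i. \<rho> i x)"
  by (auto simp: ins_def)

lemma eventually_not_iff: "(\<forall>\<^sub>F x in U. \<not> P x) \<longleftrightarrow> \<not> eventually P U"
proof
  assume "\<forall>\<^sub>F x in U. \<not> P x"
  then show "\<not> eventually P U"
    using eventually_conj[of "\<lambda>x. \<not> P x" U P] proper by auto
qed (use ultra in blast)

text \<open>A witness chosen as a function of the values of the parameters stays in the same node.\<close>

lemma eventually_ex_iff:
  assumes "\<And>i. \<rho> i \<in> stage k"
  shows "(\<forall>\<^sub>F x in U. \<exists>n. P n (\<lambda>i. \<rho> i x)) \<longleftrightarrow> (\<exists>d\<in>stage k. \<forall>\<^sub>F x in U. P (d x) (\<lambda>i. \<rho> i x))"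
proof
  assume *: "\<forall>\<^sub>F x in U. \<exists>n. P n (\<lambda>i. \<rho> i x)"
  define d where "d = (\<lambda>x. SOME n. P n (\<lambda>i. \<rho> i x))"
  have "(\<lambda>i. \<rho> i x) = (\<lambda>i. \<rho> i y)" if "\<forall>m<k. x m = y m" for x y
    using assms that by (auto simp: stage_def)
  then have "d x = d y" if "\<forall>m<k. x m = y m" for x y
    unfolding d_def using that by metis
  then have "d \<in> stage k" by (simp add: stage_def)
  moreover from * have "\<forall>\<^sub>F x in U. P (d x) (\<lambda>i. \<rho> i x)"
    unfolding d_def by eventually_elim (rule someI_ex)
  ultimately show "\<exists>d\<in>stage k. \<forall>\<^sub>F x in U. P (d x) (\<lambda>i. \<rho> i x)" by auto
qed (auto elim: eventually_mono)

text \<open>The right-hand side does not mention the node, so by induction the later nodes inspected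
  by \<open>FImp\<close> and \<open>FAll\<close> add nothing new.\<close>

theorem los:
  assumes "g \<notin> symf A" and "\<And>i. \<rho> i \<in> stage k"
  shows "forces k \<rho> A \<longleftrightarrow> (\<forall>\<^sub>F x in U. std.forces () (\<lambda>i. \<rho> i x) A)"
  using assms
proof (induction A arbitrary: k \<rho>)
  case (FEq s t)
  then show ?case
    using eqv_def[of "tval interp \<rho> s" "tval interp \<rho> t"] by (simp add: tval_pointwise)
next
  case FBot
  then show ?case using proper by simp
next
  case (FAnd A B)
  then show ?case by (simp add: eventually_conj_iff)
next
  case (FOr A B)
  have "(\<forall>\<^sub>F x in U. P x \<or> Q x) \<longleftrightarrow> eventually P U \<or> eventually Q U" for P Q
    using eventually_conj_iff[of "\<lambda>x. \<not> P x" "\<lambda>x. \<not> Q x" U]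
      eventually_not_iff[of "\<lambda>x. P x \<or> Q x"] eventually_not_iff[of P] eventually_not_iff[of Q]
    by auto
  with FOr show ?case by simp
next
  case (FImp A B)
  let ?ev = "\<lambda>C. \<forall>\<^sub>F x in U. std.forces () (\<lambda>i. \<rho> i x) C"
  have stage: "\<rho> i \<in> stage l" if "k \<le> l" for i l
    using stage_mono[OF that] FImp.prems by auto
  have "forces k \<rho> (FImp A B) \<longleftrightarrow> (?ev A \<longrightarrow> ?ev B)"
    using FImp stage by auto
  also have "\<dots> \<longleftrightarrow> (\<forall>\<^sub>F x in U. std.forces () (\<lambda>i. \<rho> i x) A \<longrightarrow> std.forces () (\<lambda>i. \<rho> i x) B)"
  proof
    assume "?ev A \<longrightarrow> ?ev B"
    then have "(\<forall>\<^sub>F x in U. \<not> std.forces () (\<lambda>i. \<rho> i x) A) \<or> ?ev B"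
      by (simp add: eventually_not_iff)
    then show "\<forall>\<^sub>F x in U. std.forces () (\<lambda>i. \<rho> i x) A \<longrightarrow> std.forces () (\<lambda>i. \<rho> i x) B"
      by (auto elim: eventually_mono)
  qed (auto elim: eventually_mp)
  finally show ?case by simp
next
  case (FAll A)
  have IH: "forces l (ins 0 d \<rho>) A
      \<longleftrightarrow> (\<forall>\<^sub>F x in U. std.forces () (ins 0 (d x) (\<lambda>i. \<rho> i x)) A)" if "k \<le> l" "d \<in> stage l" for l d
    using FAll.prems stage_mono[OF that(1)] that(2)
    by (subst FAll.IH) (auto simp: ins_pointwise, auto simp: ins_def)
  show ?case
  proof
    assume L: "forces k \<rho> (FAll A)"
    show "\<forall>\<^sub>F x in U. std.forces () (\<lambda>i. \<rho> i x) (FAll A)"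
    proof (rule ccontr)
      assume "\<not> ?thesis"
      \<comment> \<open>Counterexamples at almost all points combine into one element of
        \<open>stage k\<close>, which contradicts \<open>L\<close> at node \<open>k\<close>
        itself.\<close>
      then have "\<forall>\<^sub>F x in U. \<exists>n. \<not> std.forces () (ins 0 n (\<lambda>i. \<rho> i x)) A"
        by (simp flip: eventually_not_iff)
      then obtain d where d: "d \<in> stage k"
        "\<forall>\<^sub>F x in U. \<not> std.forces () (ins 0 (d x) (\<lambda>i. \<rho> i x)) A"
        using eventually_ex_iff[of \<rho> k "\<lambda>n \<sigma>. \<not> std.forces () (ins 0 n \<sigma>) A"] FAll.prems by auto
      then show False using L IH[of k d] by (auto simp: eventually_not_iff)
    qed
  next
    assume "\<forall>\<^sub>F x in U. std.forces () (\<lambda>i. \<rho> i x) (FAll A)"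
    then show "forces k \<rho> (FAll A)"
      using IH by (auto elim: eventually_mono)
  qed
next
  case (FEx A)
  have "forces k (ins 0 d \<rho>) A
      \<longleftrightarrow> (\<forall>\<^sub>F x in U. std.forces () (ins 0 (d x) (\<lambda>i. \<rho> i x)) A)" if "d \<in> stage k" for d
    using FEx.prems that
    by (subst FEx.IH) (auto simp: ins_pointwise, auto simp: ins_def)
  then show ?case
    using eventually_ex_iff[of \<rho> k "\<lambda>n \<sigma>. std.forces () (ins 0 n \<sigma>) A"] FEx.prems by auto
qed

lemma interp_g_eqv_iff:
  "eqv (interp g (a # b # cs)) a \<longleftrightarrow> rel a b"
  by (simp add: interp_def not_eqv_Suc)

lemma rel_absent: "b \<in> stage k \<Longrightarrow> \<not> rel (\<lambda>_. k) b"
  using coordinate_not_eqv by (auto simp: rel_def eqv_const_iff)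

lemma rel_present: "rel (\<lambda>_. k) (\<lambda>x. x k)"
  unfolding rel_def using eqv_refl by blast

lemma coordinate_in_stage: "(\<lambda>x. x k) \<in> stage (Suc k)"
  by (simp add: stage_def)

end

section \<open>The countermodel\<close>

theorem theorem6:
  fixes T :: "fm set"
  assumes "finite T"
    and "\<forall>A\<in>T. wf_fm A \<and> HA_prov A"
  shows "\<exists>\<phi> \<psi>. wf_fm \<phi> \<and> wf_fm \<psi> \<and> nnf \<phi> \<and> nnf \<psi> \<and>
           PA_prov \<phi> \<and> PA_prov (cimp \<phi> \<psi>) \<and>
           \<not> deriv False T {awk \<phi>, awk (cimp \<phi> \<psi>)} (awk \<psi>)"
proof -
  have "finite (\<Union>A\<in>T. symf A)" using assms(1) finite_symf by blast
  \<comment> \<open>Arity at least 2 leaves room for both variables of \<open>e\<close>.\<close>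
  moreover have "infinite (range (\<lambda>n. PProj (n + 2) 0))"
    by (subst finite_image_iff) (auto simp: inj_on_def)
  ultimately have "\<not> range (\<lambda>n. PProj (n + 2) 0) \<subseteq> (\<Union>A\<in>T. symf A)"
    using finite_subset by blast
  then obtain n where fresh: "\<And>A. A \<in> T \<Longrightarrow> PProj (n + 2) 0 \<notin> symf A" by auto
  define g where "g = PProj (n + 2) 0"
  \<comment> \<open>Under the two quantifiers of \<open>\<chi>\<close>, index 1 is x and index 0 is
    y; repeating y fills the arity.\<close>
  define e where "e = FEq (TApp g (TVar 1 # replicate (n + 1) (TVar 0))) (TVar 1)"
  define \<chi> where "\<chi> = FAll (FOr (FEx e) (FAll (FNot e)))"
  define \<psi> where "\<psi> = FEq (TApp g (vars (n + 2))) (TVar 0)"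
  define \<phi> where "\<phi> = FOr \<psi> \<chi>"
  have wf: "wf_fm \<psi>" "wf_fm \<phi>"
    by (auto simp: \<phi>_def \<psi>_def \<chi>_def e_def g_def vars_def FNot_def)
  have nnf: "nnf \<psi>" "nnf \<phi>"
    by (auto simp: \<phi>_def \<psi>_def \<chi>_def e_def FNot_def)
  have "\<psi> \<in> defeqs g" by (simp add: \<psi>_def g_def)
  then have "\<psi> \<in> HA_axioms"
    unfolding HA_axioms_def using wf_prf.simps(3)[of "n + 2" 0] by (auto simp: g_def simp del: defeqs.simps)
  then have "PA_prov \<psi>" by (simp add: PA_prov_def deriv.Axiom)
  then have prov: "PA_prov \<phi>" "PA_prov (cimp \<phi> \<psi>)"
    by (simp_all add: PA_prov_def \<phi>_def cimp_def deriv.OrI1 deriv.OrI2)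
  \<comment> \<open>Since \<open>e\<close> is an equation, \<open>dual\<close> undoes its negation
    in \<open>\<chi>\<close>, so \<open>awk (cimp \<phi> \<psi>)\<close> speaks of
    \<open>\<phi>\<close> itself.\<close>
  have duals: "dual \<phi> = FAnd (dual \<psi>) (dual \<chi>)" "dual (dual \<phi>) = \<phi>"
    "dual \<psi> = FNot \<psi>" "dual \<chi> = FEx (FAnd (FAll (FNot e)) (FEx e))"
    by (simp_all add: \<phi>_def \<psi>_def \<chi>_def e_def FNot_def)

  obtain U :: "(nat \<Rightarrow> nat) filter" where "iterated_ultrapower U"
    using iterated_ultrafilter_exists unfolding iterated_ultrapower_def by metis
  then interpret iterated_ultrapower U g .
  have e: "forces k \<rho> e \<longleftrightarrow> rel (\<rho> 1) (\<rho> 0)" for k \<rho>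
    by (simp add: e_def interp_g_eqv_iff)
  have chi: "\<not> forces k \<rho> \<chi>" for k \<rho>
  proof
    assume "forces k \<rho> \<chi>"
    then have "\<forall>d\<in>stage k. forces k (ins 0 d \<rho>) (FOr (FEx e) (FAll (FNot e)))"
      unfolding \<chi>_def forces.simps(6) by blast
    \<comment> \<open>The element k has no partner at node k but acquires one at node k + 1, so
      neither disjunct is forced.\<close>
    then have "forces k (ins 0 (\<lambda>_. k) \<rho>) (FOr (FEx e) (FAll (FNot e)))"
      by (rule bspec) simp
    moreover have "\<not> forces k (ins 0 (\<lambda>_. k) \<rho>) (FEx e)"
      using rel_absent by (auto simp: e)
    ultimately have "\<forall>v\<ge>k. \<forall>d\<in>stage v. \<not> rel (\<lambda>_. k) d"
      by (auto simp: e)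
    then have "\<forall>d\<in>stage (Suc k). \<not> rel (\<lambda>_. k) d"
      using le_SucI[OF order_refl] by blast
    then show False using coordinate_in_stage rel_present by blast
  qed
  have dual_chi: "\<not> forces k \<rho> (dual \<chi>)" for k \<rho>
    by (auto simp: duals)
  define \<rho> :: "nat \<Rightarrow> (nat \<Rightarrow> nat) \<Rightarrow> nat" where "\<rho> = (\<lambda>_ _. 0)"
  have vars: "vars (n + 2) = TVar 0 # TVar 1 # map TVar [2..<n + 2]"
    by (simp add: vars_def upt_conv_Cons numeral_2_eq_2 del: upt_Suc)
  \<comment> \<open>The partner of 0 is coordinate 0, which no constant equals modulo
    \<open>U\<close>; hence g(0, 0, ...) is 1 at every node.\<close>
  have psi: "\<not> forces k \<rho> \<psi>" for k
    using rel_absent[of "\<lambda>_. 0" 0]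
    unfolding \<psi>_def vars by (simp add: interp_g_eqv_iff \<rho>_def del: upt_Suc)
  have "dual (cimp \<phi> \<psi>) = FAnd \<phi> (FNot \<psi>)"
    by (simp add: cimp_def duals(2,3))
  \<comment> \<open>The first holds because \<open>dual \<chi>\<close> is never forced, the second
    because under \<open>\<rho>\<close> neither disjunct of \<open>\<phi>\<close> ever is.\<close>
  then have hyps: "forces 0 \<rho> (awk \<phi>)" "forces 0 \<rho> (awk (cimp \<phi> \<psi>))"
    using chi dual_chi psi by (simp_all add: awk_def duals(1) \<phi>_def)
  have "\<not> deriv False T {awk \<phi>, awk (cimp \<phi> \<psi>)} (awk \<psi>)"
  proof
    assume "deriv False T {awk \<phi>, awk (cimp \<phi> \<psi>)} (awk \<psi>)"
    then have "forces 0 \<rho> (awk \<psi>)"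
    proof (rule soundness)
      fix A w and \<sigma> :: "nat \<Rightarrow> (nat \<Rightarrow> nat) \<Rightarrow> nat"
      assume "A \<in> T" and "\<And>i. \<sigma> i \<in> stage w"
      \<comment> \<open>Formulas of \<open>T\<close> avoid \<open>g\<close>, so \<open>los\<close>
        reduces forcing to truth in the standard model, which provability in HA ensures.\<close>
      then show "forces w \<sigma> A"
        using fresh assms(2) std_HA_prov by (subst los) (auto simp: g_def)
    next
      fix B assume "B \<in> {awk \<phi>, awk (cimp \<phi> \<psi>)}"
      then show "forces 0 \<rho> B"
        using hyps by blast
    qed (simp add: \<rho>_def)
    then show False using psi by (auto simp: awk_def duals)
  qed
  with wf nnf prov show ?thesis by blast
qed

end
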